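(* For all $N\ge 11$ and $1\le k\le N-5$, \[ B^c_{(1,4,9)}(N,k)=4\,\mathcal{C}_1(N,k)-9\,\mathcal{C}_2(N,k)+2\,\mathcal{C}_4(N,k)+105\,\mathcal{C}_5(N,k)-206\,\mathcal{C}_6(N,k)+95\,\mathcal{C}_7(N,k)-5\,\mathcal{C}_8(N,k). \]
   Context: $\mathrm{Av}_N(321)$ is the set of permutations $\pi=\pi_1\cdots\pi_N$ of $[N]$ with no indices $a<b<c$ such that $\pi_a>\pi_b>\pi_c$. $\pi|_{[j]}$ is the permutation of $[j]$ in the same relative order as $\pi_1,\dots,\pi_j$. An entry $\pi_j$ is a left-to-right maximum if $\pi_j>\pi_l$ for all $l<j$. For a permutation $p$ of $[m]$, its number of value-saturated left-to-right maxima is the largest $r$ such that each of the values $m,m-1,\dots,m-r+1$ is a left-to-right maximum of $p$. Let $\tau(0)=\tau(1)=1$, $\tau(2)=4$, $\tau(3)=9$ and $\tau(i)=\infty$ for $i\ge4$. $B^c_{(1,4,9)}(N,k)$ is the number of $\pi\in\mathrm{Av}_N(321)$ with $\pi|_{[k]}=12\cdots k$ such that $\pi_j=N$, where $j$ is the first position $j>k$ with $\pi_j$ a left-to-right maximum and the number of value-saturated left-to-right maxima of $\pi|_{[j]}$ at least $\tau(N-j)$ (such $\pi$ are those won by this threshold strategy). The $i$-shifted ballot numbers are $\mathcal{C}_i(N,k)=\frac{k+1}{N-i+1}\binom{2(N-i)-k}{N-i}$, where binomial coefficients $\binom{a}{b}$ with $b>a$ are interpreted as $0$. *)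

theory Defs
  imports Complex_Main "HOL-Library.Extended_Nat" "HOL-Combinatorics.Permutations"
begin

text \<open>
  A permutation of \<open>[N]\<close> is a function \<open>p\<close> with \<open>p permutes {1..N}\<close>; positions and values are both
  counted from 1, and \<open>p\<close> is the identity outside \<open>{1..N}\<close>.
\<close>

definition Av321 :: "nat \<Rightarrow> (nat \<Rightarrow> nat) set" where
  "Av321 N = {p. p permutes {1..N} \<and>
     \<not> (\<exists>a b c. 1 \<le> a \<and> a < b \<and> b < c \<and> c \<le> N \<and> p a > p b \<and> p b > p c)}"

text \<open>
  \<open>\<pi>|\<^sub>[\<^sub>j\<^sub>]\<close>: position \<open>i \<le> j\<close> carries the rank of \<open>p i\<close> among \<open>p 1, \<dots>, p j\<close>. Extending by the identity
  outside \<open>{1..j}\<close> makes the result a permutation of \<open>{1..j}\<close> in the above sense, so that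
  \<open>\<pi>|\<^sub>[\<^sub>k\<^sub>] = 12\<cdots>k\<close> reads \<open>prefix_pattern p k = id\<close>.
\<close>

definition prefix_pattern :: "(nat \<Rightarrow> nat) \<Rightarrow> nat \<Rightarrow> (nat \<Rightarrow> nat)" where
  "prefix_pattern p j = (\<lambda>i. if i \<in> {1..j} then card {l \<in> {1..j}. p l \<le> p i} else i)"

definition lr_max :: "(nat \<Rightarrow> nat) \<Rightarrow> nat \<Rightarrow> bool" where
  "lr_max p j \<longleftrightarrow> (\<forall>l \<in> {1..<j}. p l < p j)"

text \<open>The values \<open>m, m-1, \<dots>, m-r+1\<close> form the set \<open>{m - r<..m}\<close>, which is empty for \<open>r = 0\<close>.\<close>

definition num_vs_lr_max :: "nat \<Rightarrow> (nat \<Rightarrow> nat) \<Rightarrow> nat" where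
  "num_vs_lr_max m p =
     Max {r \<in> {0..m}. \<forall>v \<in> {m - r<..m}. \<exists>i \<in> {1..m}. p i = v \<and> lr_max p i}"

definition acceptable :: "(nat \<Rightarrow> enat) \<Rightarrow> nat \<Rightarrow> nat \<Rightarrow> (nat \<Rightarrow> nat) \<Rightarrow> nat \<Rightarrow> bool" where
  "acceptable \<tau> N k p j \<longleftrightarrow> j \<in> {k<..N} \<and> lr_max p j \<and>
     enat (num_vs_lr_max j (prefix_pattern p j)) \<ge> \<tau> (N - j)"

text \<open>A permutation without an acceptable position is not won.\<close>

definition wins :: "(nat \<Rightarrow> enat) \<Rightarrow> nat \<Rightarrow> nat \<Rightarrow> (nat \<Rightarrow> nat) \<Rightarrow> bool" where
  "wins \<tau> N k p \<longleftrightarrow>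
     (\<exists>j. acceptable \<tau> N k p j \<and> (\<forall>i<j. \<not> acceptable \<tau> N k p i) \<and> p j = N)"

definition B_c :: "(nat \<Rightarrow> enat) \<Rightarrow> nat \<Rightarrow> nat \<Rightarrow> nat" where
  "B_c \<tau> N k = card {p \<in> Av321 N. prefix_pattern p k = id \<and> wins \<tau> N k p}"

definition tau149 :: "nat \<Rightarrow> enat" where
  "tau149 i = (if i = 0 then 1 else if i = 1 then 1 else if i = 2 then 4
               else if i = 3 then 9 else \<infinity>)"

text \<open>
  Integer arguments avoid truncated subtraction; the \<open>else\<close> branch is only reached with
  \<open>0 \<le> b \<le> a\<close> below, since there \<open>a = 2 * b - k\<close>.
\<close>

definition binom0 :: "int \<Rightarrow> int \<Rightarrow> nat" where
  "binom0 a b = (if b > a then 0 else nat a choose nat b)"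

definition shifted_ballot :: "nat \<Rightarrow> nat \<Rightarrow> nat \<Rightarrow> real" where
  "shifted_ballot i N k =
     (real k + 1) / (real N - real i + 1) *
     real (binom0 (2 * (int N - int i) - int k) (int N - int i))"

end

(*
  Deleting the last entry makes Av(321) a generating tree: a node whose permutation has r
  value-saturated left-to-right maxima has one child with r + 1 of them (append a new maximum) and,
  for each t = 1, ..., r, one child with t of them. Acceptance depends on the node only through r,
  so the number of winning leaves below an undecided node at distance i from the leaves is a
  function L_i of r. Since tau is infinite from 4 on, L_(i+1) = T L_i for i >= 4, where
  T f r = f (r + 1) + f 1 + ... + f r. The same operator T raises the first index of the ballot
  numbers, so it suffices to write L_4 as a combination of ballot numbers plus a function of finite
  support. Each application of T to that function splits off a constant, i.e. a multiple of the
  ballot number of index 0, and leaves a shorter support; after four steps nothing remains. The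
  constants are the coefficients 105, -206, 95, -5.
*)

theory Submission
  imports Defs
begin

section \<open>Relative order of prefixes\<close>

lemma prefix_pattern_cong:
  assumes "\<And>a b. a \<in> {1..j} \<Longrightarrow> b \<in> {1..j} \<Longrightarrow> p a \<le> p b \<longleftrightarrow> q a \<le> q b"
  shows "prefix_pattern p j = prefix_pattern q j"
proof
  fix i
  have "i \<in> {1..j} \<Longrightarrow> {l \<in> {1..j}. p l \<le> p i} = {l \<in> {1..j}. q l \<le> q i}"
    using assms by blast
  then show "prefix_pattern p j i = prefix_pattern q j i"
    unfolding prefix_pattern_def by simp
qed

lemma prefix_pattern_le_iff:
  assumes "a \<in> {1..j}" "b \<in> {1..j}"
  shows "prefix_pattern p j a \<le> prefix_pattern p j b \<longleftrightarrow> p a \<le> p b"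
proof
  assume "p a \<le> p b"
  then have "card {l \<in> {1..j}. p l \<le> p a} \<le> card {l \<in> {1..j}. p l \<le> p b}"
    by (intro card_mono) auto
  then show "prefix_pattern p j a \<le> prefix_pattern p j b"
    using assms by (simp add: prefix_pattern_def)
next
  assume le: "prefix_pattern p j a \<le> prefix_pattern p j b"
  show "p a \<le> p b"
  proof (rule ccontr)
    assume "\<not> p a \<le> p b"
    then have "a \<in> {l \<in> {1..j}. p l \<le> p a}" "a \<notin> {l \<in> {1..j}. p l \<le> p b}"
      and "{l \<in> {1..j}. p l \<le> p b} \<subseteq> {l \<in> {1..j}. p l \<le> p a}"
      using assms by auto
    then have "card {l \<in> {1..j}. p l \<le> p b} < card {l \<in> {1..j}. p l \<le> p a}"
      by (intro psubset_card_mono) auto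
    then show False
      using le assms by (simp add: prefix_pattern_def)
  qed
qed

lemma prefix_pattern_less_iff:
  assumes "a \<in> {1..j}" "b \<in> {1..j}"
  shows "prefix_pattern p j a < prefix_pattern p j b \<longleftrightarrow> p a < p b"
  using prefix_pattern_le_iff[OF assms(2,1), of p] by linarith

lemma permutes_atLeastAtMostI:
  fixes p :: "nat \<Rightarrow> nat"
  assumes "inj_on p {1..m}" "p ` {1..m} \<subseteq> {1..m}" "\<And>i. i \<notin> {1..m} \<Longrightarrow> p i = i"
  shows "p permutes {1..m}"
  using assms endo_inj_surj[of "{1..m}" p] by (intro bij_imp_permutes) (auto simp: bij_betw_def)

lemma prefix_pattern_permutes:
  assumes "inj_on p {1..j}"
  shows "prefix_pattern p j permutes {1..j}"
proof (rule permutes_atLeastAtMostI)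
  show "inj_on (prefix_pattern p j) {1..j}"
    using assms by (intro inj_onI) (metis inj_onD order.refl order_antisym prefix_pattern_le_iff)
  show "prefix_pattern p j ` {1..j} \<subseteq> {1..j}"
  proof
    fix x assume "x \<in> prefix_pattern p j ` {1..j}"
    then obtain i where i: "i \<in> {1..j}" "x = card {l \<in> {1..j}. p l \<le> p i}"
      by (auto simp: prefix_pattern_def)
    have "card {l \<in> {1..j}. p l \<le> p i} \<le> card {1..j}"
      by (intro card_mono) auto
    moreover have "card {l \<in> {1..j}. p l \<le> p i} > 0"
      using i by (auto simp: card_gt_0_iff)
    ultimately show "x \<in> {1..j}"
      using i by simp
  qed
qed (auto simp: prefix_pattern_def)

lemma permutes_bounds:
  fixes p :: "nat \<Rightarrow> nat"
  assumes "p permutes {1..m}" "i \<in> {1..m}"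
  shows "1 \<le> p i" "p i \<le> m"
  using permutes_in_image[OF assms(1), of i] assms(2) by auto

text \<open>\<open>p\<close> maps the counted positions bijectively onto \<open>{1..x}\<close>. This
  identifies a value with its rank.\<close>

lemma permutes_card_le:
  fixes p :: "nat \<Rightarrow> nat"
  assumes "p permutes {1..m}" "x \<le> m"
  shows "card {l \<in> {1..m}. p l \<le> x} = x"
proof -
  have "p ` {l \<in> {1..m}. p l \<le> x} = {1..x}"
  proof
    show "p ` {l \<in> {1..m}. p l \<le> x} \<subseteq> {1..x}"
      using permutes_bounds[OF assms(1)] by auto
    show "{1..x} \<subseteq> p ` {l \<in> {1..m}. p l \<le> x}"
    proof
      fix y assume y: "y \<in> {1..x}"
      then have "y \<in> p ` {1..m}"
        using permutes_image[OF assms(1)] assms(2) by auto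
      then show "y \<in> p ` {l \<in> {1..m}. p l \<le> x}"
        using y by auto
    qed
  qed
  then show ?thesis
    using card_image[of p "{l \<in> {1..m}. p l \<le> x}"] permutes_inj_on[OF assms(1)] by simp
qed

lemma prefix_pattern_self:
  assumes "p permutes {1..m}"
  shows "prefix_pattern p m = p"
proof
  fix i
  show "prefix_pattern p m i = p i"
    using permutes_card_le[OF assms, of "p i"] permutes_in_image[OF assms, of i]
      permutes_not_in[OF assms, of i]
    by (auto simp: prefix_pattern_def)
qed

text \<open>Ranks in a longer prefix keep the order of a shorter one, so the prefix patterns of a
  permutation form a path in the generating tree.\<close>

lemma prefix_pattern_prefix_pattern:
  assumes "i \<le> j"
  shows "prefix_pattern (prefix_pattern p j) i = prefix_pattern p i"
  using assms by (intro prefix_pattern_cong) (auto simp: prefix_pattern_le_iff)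

lemma lr_max_prefix_pattern:
  assumes "i \<in> {1..j}"
  shows "lr_max (prefix_pattern p j) i \<longleftrightarrow> lr_max p i"
  using assms unfolding lr_max_def by (auto simp: prefix_pattern_less_iff)

lemma Av321_permutes: "p \<in> Av321 m \<Longrightarrow> p permutes {1..m}"
  by (simp add: Av321_def)

lemma Av321_prefix_pattern:
  assumes "p \<in> Av321 N" "j \<le> N"
  shows "prefix_pattern p j \<in> Av321 j"
proof -
  have "inj_on p {1..j}"
    using Av321_permutes[OF assms(1)] permutes_inj_on by blast
  moreover have "\<not> (\<exists>a b c. 1 \<le> a \<and> a < b \<and> b < c \<and> c \<le> j \<and>
      prefix_pattern p j a > prefix_pattern p j b \<and> prefix_pattern p j b > prefix_pattern p j c)"
  proof
    assume "\<exists>a b c. 1 \<le> a \<and> a < b \<and> b < c \<and> c \<le> j \<and>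
      prefix_pattern p j a > prefix_pattern p j b \<and> prefix_pattern p j b > prefix_pattern p j c"
    then obtain a b c where abc: "1 \<le> a" "a < b" "b < c" "c \<le> j"
      "prefix_pattern p j a > prefix_pattern p j b" "prefix_pattern p j b > prefix_pattern p j c"
      by blast
    then have "p a > p b" "p b > p c"
      using prefix_pattern_less_iff[of b j a p] prefix_pattern_less_iff[of c j b p] by auto
    then show False
      using assms abc unfolding Av321_def by (auto dest: order.trans)
  qed
  ultimately show ?thesis
    unfolding Av321_def using prefix_pattern_permutes[of p j] by blast
qed

lemma finite_Av321: "finite (Av321 N)"
  by (rule finite_subset[OF _ finite_permutations[of "{1..N}"]]) (auto simp: Av321_def)

section \<open>Appending a last entry\<close>

text \<open>For a permutation \<open>q\<close>, this inverts the deletion of the last entry followed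
  by taking ranks.\<close>

definition append_value :: "nat \<Rightarrow> (nat \<Rightarrow> nat) \<Rightarrow> nat \<Rightarrow> nat \<Rightarrow> nat" where
  "append_value m q v =
     (\<lambda>i. if i \<in> {1..m} then (if v \<le> q i then Suc (q i) else q i)
          else if i = Suc m then v else i)"

lemma append_value_le_iff:
  "a \<in> {1..m} \<Longrightarrow> b \<in> {1..m} \<Longrightarrow> append_value m q v a \<le> append_value m q v b \<longleftrightarrow> q a \<le> q b"
  by (auto simp: append_value_def)

lemma append_value_less_iff:
  "a \<in> {1..m} \<Longrightarrow> b \<in> {1..m} \<Longrightarrow> append_value m q v a < append_value m q v b \<longleftrightarrow> q a < q b"
  by (auto simp: append_value_def)

lemma prefix_pattern_append_value:
  assumes "q permutes {1..m}"
  shows "prefix_pattern (append_value m q v) m = q"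
  using prefix_pattern_cong[of m "append_value m q v" q] append_value_le_iff
    prefix_pattern_self[OF assms] by simp

lemma append_value_permutes:
  assumes "q permutes {1..m}" "v \<in> {1..Suc m}"
  shows "append_value m q v permutes {1..Suc m}"
proof (rule permutes_atLeastAtMostI)
  have "append_value m q v a \<noteq> append_value m q v b" if "a \<in> {1..Suc m}" "b \<in> {1..Suc m}" "a < b" for a b
  proof (cases "b = Suc m")
    case True
    then show ?thesis
      using that by (auto simp: append_value_def)
  next
    case False
    have "q a \<noteq> q b"
      using that permutes_inj[OF assms(1)] by (auto dest: injD)
    then show ?thesis
      using that False by (auto simp: append_value_def)
  qed
  then show "inj_on (append_value m q v) {1..Suc m}"
    by (auto intro!: linorder_inj_onI)
  show "append_value m q v ` {1..Suc m} \<subseteq> {1..Suc m}"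
  proof (rule image_subsetI)
    fix i assume "i \<in> {1..Suc m}"
    then show "append_value m q v i \<in> {1..Suc m}"
      using permutes_bounds[OF assms(1), of i] assms(2)
      by (cases "i = Suc m") (auto simp: append_value_def)
  qed
qed (auto simp: append_value_def)

lemma append_value_prefix_pattern:
  assumes "p permutes {1..Suc m}"
  shows "append_value m (prefix_pattern p m) (p (Suc m)) = p"
proof
  fix i
  show "append_value m (prefix_pattern p m) (p (Suc m)) i = p i"
  proof (cases "i \<in> {1..m}")
    case True
    have pi: "p i \<le> Suc m" "p i \<noteq> p (Suc m)"
      using True permutes_bounds[OF assms, of i] inj_eq[OF permutes_inj[OF assms], of i "Suc m"]
      by auto
    have "p i = card {l \<in> {1..Suc m}. p l \<le> p i}"
      using permutes_card_le[OF assms, of "p i"] pi by simp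
    also have "{l \<in> {1..Suc m}. p l \<le> p i} =
        (if p (Suc m) < p i then insert (Suc m) {l \<in> {1..m}. p l \<le> p i} else {l \<in> {1..m}. p l \<le> p i})"
      using pi by (auto simp: le_Suc_eq)
    also have "card \<dots> = prefix_pattern p m i + of_bool (p (Suc m) < p i)"
      using True by (simp add: prefix_pattern_def)
    \<comment> \<open>Since the pattern lowers such a rank by one, the strict
      \<open>p (Suc m) < p i\<close> turns into the weak inequality tested by
      \<open>append_value\<close>.\<close>
    finally show ?thesis
      using True pi by (cases "p (Suc m) < p i") (auto simp: append_value_def)
  next
    case False
    then show ?thesis
      using permutes_not_in[OF assms, of i] by (auto simp: append_value_def)
  qed
qed

section \<open>Value-saturated left-to-right maxima\<close>

text \<open>A permutation takes each value at exactly one position, so a condition on values becomes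
  one on entries, free of truncated subtraction.\<close>

lemma vs_lr_max_iff:
  assumes "q permutes {1..m}" "s \<le> m"
  shows "(\<forall>v \<in> {m - s<..m}. \<exists>i \<in> {1..m}. q i = v \<and> lr_max q i) \<longleftrightarrow>
    (\<forall>i \<in> {1..m}. m < q i + s \<longrightarrow> lr_max q i)"
proof
  assume L: "\<forall>v \<in> {m - s<..m}. \<exists>i \<in> {1..m}. q i = v \<and> lr_max q i"
  show "\<forall>i \<in> {1..m}. m < q i + s \<longrightarrow> lr_max q i"
  proof (intro ballI impI)
    fix i assume i: "i \<in> {1..m}" "m < q i + s"
    then have "q i \<in> {m - s<..m}"
      using permutes_in_image[OF assms(1), of i] assms by auto
    then obtain i' where "q i' = q i" "lr_max q i'"
      using L by blast
    then show "lr_max q i"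
      using permutes_inj[OF assms(1)] by (auto dest: injD)
  qed
next
  assume R: "\<forall>i \<in> {1..m}. m < q i + s \<longrightarrow> lr_max q i"
  show "\<forall>v \<in> {m - s<..m}. \<exists>i \<in> {1..m}. q i = v \<and> lr_max q i"
  proof
    fix v assume v: "v \<in> {m - s<..m}"
    then have "v \<in> q ` {1..m}"
      using permutes_image[OF assms(1)] by auto
    then show "\<exists>i \<in> {1..m}. q i = v \<and> lr_max q i"
      using R v assms by fastforce
  qed
qed

lemma num_vs_lr_max_eq_Max:
  assumes "q permutes {1..m}"
  shows "num_vs_lr_max m q = Max {s \<in> {0..m}. \<forall>i \<in> {1..m}. m < q i + s \<longrightarrow> lr_max q i}"
proof -
  have "{s \<in> {0..m}. \<forall>v \<in> {m - s<..m}. \<exists>i \<in> {1..m}. q i = v \<and> lr_max q i} =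
     {s \<in> {0..m}. \<forall>i \<in> {1..m}. m < q i + s \<longrightarrow> lr_max q i}"
    using vs_lr_max_iff[OF assms] by auto
  then show ?thesis
    unfolding num_vs_lr_max_def by simp
qed

lemma num_vs_lr_max_le_and_lr_max:
  assumes "q permutes {1..m}"
  shows "num_vs_lr_max m q \<le> m \<and> (\<forall>i \<in> {1..m}. m < q i + num_vs_lr_max m q \<longrightarrow> lr_max q i)"
proof -
  let ?S = "{s \<in> {0..m}. \<forall>i \<in> {1..m}. m < q i + s \<longrightarrow> lr_max q i}"
  \<comment> \<open>No entry exceeds \<open>m\<close>, so \<open>s = 0\<close> qualifies vacuously
    and the maximum is attained.\<close>
  have "0 \<in> ?S"
    using permutes_bounds[OF assms] by (simp add: not_less[symmetric])
  then have "Max ?S \<in> ?S"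
    by (intro Max_in) auto
  then show ?thesis
    by (simp add: num_vs_lr_max_eq_Max[OF assms])
qed

text \<open>The condition passes from \<open>s\<close> to every smaller number, so holding up to the
  maximum means holding at \<open>s\<close>. Later arguments use this form instead of
  \<open>Max\<close>.\<close>

lemma le_num_vs_lr_max_iff:
  assumes "q permutes {1..m}" "s \<le> m"
  shows "s \<le> num_vs_lr_max m q \<longleftrightarrow> (\<forall>i \<in> {1..m}. m < q i + s \<longrightarrow> lr_max q i)"
proof
  assume "s \<le> num_vs_lr_max m q"
  then show "\<forall>i \<in> {1..m}. m < q i + s \<longrightarrow> lr_max q i"
    using num_vs_lr_max_le_and_lr_max[OF assms(1)] by auto
next
  assume "\<forall>i \<in> {1..m}. m < q i + s \<longrightarrow> lr_max q i"
  then show "s \<le> num_vs_lr_max m q"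
    unfolding num_vs_lr_max_eq_Max[OF assms(1)] using assms(2) by (intro Max_ge) auto
qed

lemma num_vs_lr_max_le: "q permutes {1..m} \<Longrightarrow> num_vs_lr_max m q \<le> m"
  using num_vs_lr_max_le_and_lr_max by blast

lemma num_vs_lr_max_eqI:
  assumes "q permutes {1..m}" "r \<le> m"
    and "\<And>s. s \<le> m \<Longrightarrow> (\<forall>i \<in> {1..m}. m < q i + s \<longrightarrow> lr_max q i) \<longleftrightarrow> s \<le> r"
  shows "num_vs_lr_max m q = r"
  using assms le_num_vs_lr_max_iff[OF assms(1)] num_vs_lr_max_le[OF assms(1)]
  by (metis order.refl order_antisym)

lemma lr_max_append_value:
  "i \<in> {1..m} \<Longrightarrow> lr_max (append_value m q v) i \<longleftrightarrow> lr_max q i"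
  unfolding lr_max_def using append_value_less_iff[of _ m i q v] by auto

text \<open>If \<open>v \<le> m\<close>, the entry of \<open>q\<close> with value \<open>v\<close>
  is pushed to \<open>Suc v\<close> and exceeds the last entry.\<close>

lemma lr_max_append_value_Suc:
  assumes "q permutes {1..m}" "v \<in> {1..Suc m}"
  shows "lr_max (append_value m q v) (Suc m) \<longleftrightarrow> v = Suc m"
proof
  assume "v = Suc m"
  then show "lr_max (append_value m q v) (Suc m)"
    using permutes_bounds(2)[OF assms(1)] unfolding lr_max_def append_value_def
    by (simp add: less_Suc_eq_le not_le le_Suc_eq)
next
  assume L: "lr_max (append_value m q v) (Suc m)"
  show "v = Suc m"
  proof (rule ccontr)
    assume "v \<noteq> Suc m"
    then have "v \<in> q ` {1..m}"
      using assms permutes_image[OF assms(1)] by auto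
    then obtain i where "i \<in> {1..m}" "q i = v"
      by auto
    then show False
      using L unfolding lr_max_def append_value_def by force
  qed
qed

text \<open>The older entries keep their values below the new top value, which is itself a
  left-to-right maximum, so the saturated run gains one element.\<close>

lemma num_vs_append_max:
  assumes "q permutes {1..m}"
  shows "num_vs_lr_max (Suc m) (append_value m q (Suc m)) = Suc (num_vs_lr_max m q)"
proof (rule num_vs_lr_max_eqI)
  show "append_value m q (Suc m) permutes {1..Suc m}"
    using append_value_permutes[OF assms] by simp
  show "Suc (num_vs_lr_max m q) \<le> Suc m"
    using num_vs_lr_max_le[OF assms] by simp
  fix s assume s: "s \<le> Suc m"
  have last: "lr_max (append_value m q (Suc m)) (Suc m)"
    using lr_max_append_value_Suc[OF assms] by simp
  \<comment> \<open>At \<open>s = 0\<close> the truncated \<open>s - 1\<close> is \<open>0\<close>,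
    and both sides hold vacuously.\<close>
  have "(\<forall>i \<in> {1..Suc m}. Suc m < append_value m q (Suc m) i + s \<longrightarrow>
        lr_max (append_value m q (Suc m)) i) \<longleftrightarrow> (\<forall>i \<in> {1..m}. m < q i + (s - 1) \<longrightarrow> lr_max q i)"
  proof -
    have "(Suc m < append_value m q (Suc m) i + s) = (m < q i + (s - 1))" if "i \<in> {1..m}" for i
      using that permutes_in_image[OF assms, of i] by (cases s) (auto simp: append_value_def)
    then show ?thesis
      using last lr_max_append_value[of _ m q "Suc m"]
      by (simp add: atLeastAtMostSuc_conv)
  qed
  also have "\<dots> \<longleftrightarrow> s \<le> Suc (num_vs_lr_max m q)"
    using le_num_vs_lr_max_iff[OF assms, of "s - 1"] s by (simp add: le_diff_conv)
  finally show "(\<forall>i \<in> {1..Suc m}. Suc m < append_value m q (Suc m) i + s \<longrightarrow>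
        lr_max (append_value m q (Suc m)) i) \<longleftrightarrow> s \<le> Suc (num_vs_lr_max m q)" .
qed

text \<open>Exactly \<open>t\<close> values lie above the new entry: the top \<open>t\<close> values
  of \<open>q\<close>, raised by one and still left-to-right maxima. The new entry is not one, so
  the run stops just above it.\<close>

lemma num_vs_append_nonmax:
  assumes "q permutes {1..m}" "t \<in> {1..num_vs_lr_max m q}"
  shows "num_vs_lr_max (Suc m) (append_value m q (Suc m - t)) = t"
proof (rule num_vs_lr_max_eqI)
  let ?v = "Suc m - t"
  have t: "1 \<le> t" "t \<le> m"
    using assms(2) num_vs_lr_max_le[OF assms(1)] by auto
  then have v: "?v \<in> {1..Suc m}" "?v \<noteq> Suc m"
    by auto
  show "append_value m q ?v permutes {1..Suc m}"
    using append_value_permutes[OF assms(1) v(1)] .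
  show "t \<le> Suc m"
    using t by simp
  fix s assume s: "s \<le> Suc m"
  show "(\<forall>i \<in> {1..Suc m}. Suc m < append_value m q ?v i + s \<longrightarrow>
        lr_max (append_value m q ?v) i) \<longleftrightarrow> s \<le> t"
  proof
    assume "\<forall>i \<in> {1..Suc m}. Suc m < append_value m q ?v i + s \<longrightarrow> lr_max (append_value m q ?v) i"
    then have "\<not> Suc m < append_value m q ?v (Suc m) + s"
      using lr_max_append_value_Suc[OF assms(1) v(1)] v(2) by auto
    then show "s \<le> t"
      using t by (auto simp: append_value_def)
  next
    assume st: "s \<le> t"
    show "\<forall>i \<in> {1..Suc m}. Suc m < append_value m q ?v i + s \<longrightarrow> lr_max (append_value m q ?v) i"
    proof (intro ballI impI)
      fix i assume i: "i \<in> {1..Suc m}" "Suc m < append_value m q ?v i + s"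
      then have im: "i \<in> {1..m}"
        using st t by (cases "i = Suc m") (auto simp: append_value_def)
      then have "m < q i + num_vs_lr_max m q"
        using i st t assms(2) by (auto simp: append_value_def split: if_splits)
      then show "lr_max (append_value m q ?v) i"
        using num_vs_lr_max_le_and_lr_max[OF assms(1)] im lr_max_append_value[OF im, of q ?v] by blast
    qed
  qed
qed

section \<open>Children in the generating tree of 321-avoiding permutations\<close>

text \<open>A new 321 ends in the new entry, and its middle element has value at least
  \<open>v\<close> in \<open>q\<close> without being a left-to-right maximum. So the top
  \<open>Suc m - v\<close> values of \<open>q\<close> must all be left-to-right maxima.\<close>

lemma append_value_Av321_iff:
  assumes "q \<in> Av321 m" "v \<in> {1..Suc m}"
  shows "append_value m q v \<in> Av321 (Suc m) \<longleftrightarrow> Suc m \<le> v + num_vs_lr_max m q"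
proof -
  have q: "q permutes {1..m}"
    using assms(1) Av321_permutes by blast
  have av: "append_value m q v permutes {1..Suc m}"
    using append_value_permutes[OF q assms(2)] .
  have "Suc m \<le> v + num_vs_lr_max m q \<longleftrightarrow> (\<forall>i \<in> {1..m}. v \<le> q i \<longrightarrow> lr_max q i)"
  proof -
    have "Suc m \<le> v + num_vs_lr_max m q \<longleftrightarrow> Suc m - v \<le> num_vs_lr_max m q"
      by auto
    also have "\<dots> \<longleftrightarrow> (\<forall>i \<in> {1..m}. m < q i + (Suc m - v) \<longrightarrow> lr_max q i)"
      using le_num_vs_lr_max_iff[OF q, of "Suc m - v"] assms(2) by auto
    also have "\<dots> \<longleftrightarrow> (\<forall>i \<in> {1..m}. v \<le> q i \<longrightarrow> lr_max q i)"
    proof -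
      have "m < x + (Suc m - v) \<longleftrightarrow> v \<le> x" for x
        using assms(2) by auto
      then show ?thesis
        by simp
    qed
    finally show ?thesis .
  qed
  also have "\<dots> \<longleftrightarrow> append_value m q v \<in> Av321 (Suc m)"
  proof
    assume *: "append_value m q v \<in> Av321 (Suc m)"
    show "\<forall>i \<in> {1..m}. v \<le> q i \<longrightarrow> lr_max q i"
    proof (intro ballI impI)
      fix i assume i: "i \<in> {1..m}" "v \<le> q i"
      show "lr_max q i"
        unfolding lr_max_def
      proof (rule ballI, rule ccontr)
        \<comment> \<open>A larger entry at \<open>l\<close>, the entry at \<open>i\<close> and the
          appended one would form a 321.\<close>
        fix l assume l: "l \<in> {1..<i}" "\<not> q l < q i"
        moreover have "q l \<noteq> q i"
          using l permutes_inj[OF q] by (auto dest: injD)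
        ultimately have "append_value m q v l > append_value m q v i"
          "append_value m q v i > append_value m q v (Suc m)"
          using i by (auto simp: append_value_def)
        moreover have "1 \<le> l" "l < i" "i < Suc m"
          using l i by auto
        ultimately show False
          using * unfolding Av321_def by blast
      qed
    qed
  next
    assume *: "\<forall>i \<in> {1..m}. v \<le> q i \<longrightarrow> lr_max q i"
    have False if abc: "1 \<le> a" "a < b" "b < c" "c \<le> Suc m"
      "append_value m q v a > append_value m q v b" "append_value m q v b > append_value m q v c" for a b c
    proof -
      have ab: "q b < q a"
        using append_value_less_iff[of b m a q v] abc by auto
      show False
      proof (cases "c = Suc m")
        case True
        then have "v \<le> q b"
          using abc by (auto simp: append_value_def split: if_splits)
        then have "q a < q b"
          using * abc True by (auto simp: lr_max_def)
        then show False
          using ab by simp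
      next
        case False
        then have "q c < q b"
          using append_value_less_iff[of c m b q v] abc by auto
        then show False
          using ab abc False assms(1) by (auto simp: Av321_def)
      qed
    qed
    then show "append_value m q v \<in> Av321 (Suc m)"
      unfolding Av321_def using av by blast
  qed
  finally show ?thesis
    by blast
qed

lemma append_value_Suc_self: "append_value m q v (Suc m) = v"
  by (simp add: append_value_def)

text \<open>The index \<open>t\<close> is the number of values above the last entry. The new maximum
  is \<open>t = 0\<close>; for \<open>t \<ge> 1\<close> it equals the statistic of the child, by
  \<open>num_vs_append_nonmax\<close>.\<close>

lemma Av321_children:
  assumes "q \<in> Av321 m"
  shows "{q' \<in> Av321 (Suc m). prefix_pattern q' m = q} =
    (\<lambda>t. append_value m q (Suc m - t)) ` {0..num_vs_lr_max m q}"
proof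
  have q: "q permutes {1..m}"
    using assms Av321_permutes by blast
  show "{q' \<in> Av321 (Suc m). prefix_pattern q' m = q} \<subseteq>
    (\<lambda>t. append_value m q (Suc m - t)) ` {0..num_vs_lr_max m q}"
  proof
    fix q' assume *: "q' \<in> {q' \<in> Av321 (Suc m). prefix_pattern q' m = q}"
    then have q': "q' permutes {1..Suc m}"
      using Av321_permutes by blast
    have v: "q' (Suc m) \<in> {1..Suc m}"
      using permutes_in_image[OF q', of "Suc m"] by simp
    have eq: "append_value m q (q' (Suc m)) = q'"
      using append_value_prefix_pattern[OF q'] * by simp
    then have "Suc m \<le> q' (Suc m) + num_vs_lr_max m q"
      using append_value_Av321_iff[OF assms v] * by simp
    then have "Suc m - q' (Suc m) \<in> {0..num_vs_lr_max m q}"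
      "q' = append_value m q (Suc m - (Suc m - q' (Suc m)))"
      using v eq by auto
    then show "q' \<in> (\<lambda>t. append_value m q (Suc m - t)) ` {0..num_vs_lr_max m q}"
      by blast
  qed
  show "(\<lambda>t. append_value m q (Suc m - t)) ` {0..num_vs_lr_max m q} \<subseteq>
    {q' \<in> Av321 (Suc m). prefix_pattern q' m = q}"
  proof
    fix q' assume "q' \<in> (\<lambda>t. append_value m q (Suc m - t)) ` {0..num_vs_lr_max m q}"
    then obtain t where t: "t \<le> num_vs_lr_max m q" "q' = append_value m q (Suc m - t)"
      by auto
    then have "Suc m - t \<in> {1..Suc m}" "Suc m \<le> (Suc m - t) + num_vs_lr_max m q"
      using num_vs_lr_max_le[OF q] by auto
    then show "q' \<in> {q' \<in> Av321 (Suc m). prefix_pattern q' m = q}"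
      using t append_value_Av321_iff[OF assms] prefix_pattern_append_value[OF q] by simp
  qed
qed

section \<open>Winning leaves below a node and their recursion\<close>

text \<open>Acceptance at \<open>i\<close> depends on the first \<open>i\<close> entries only, so it
  is settled at every node of level at least \<open>i\<close>.\<close>

lemma acceptable_prefix_pattern:
  assumes "i \<le> j"
  shows "acceptable \<tau> N k (prefix_pattern p j) i \<longleftrightarrow> acceptable \<tau> N k p i"
  using assms lr_max_prefix_pattern[of i j p] prefix_pattern_prefix_pattern[OF assms, of p]
  unfolding acceptable_def by auto

definition winning :: "(nat \<Rightarrow> enat) \<Rightarrow> nat \<Rightarrow> nat \<Rightarrow> nat \<Rightarrow> (nat \<Rightarrow> nat) \<Rightarrow> (nat \<Rightarrow> nat) set" where
  "winning \<tau> N k j q = {p \<in> Av321 N. prefix_pattern p j = q \<and> wins \<tau> N k p}"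

lemma winning_disjoint:
  "q \<noteq> q' \<Longrightarrow> winning \<tau> N k j q \<inter> winning \<tau> N k j q' = {}"
  unfolding winning_def by blast

text \<open>Every leaf below \<open>q\<close> passes through exactly one child, its prefix pattern
  of length \<open>Suc j\<close>. The child with a new maximum is kept apart because only there can
  the new position be acceptable.\<close>

lemma card_winning_step:
  assumes "q \<in> Av321 j" "j < N"
  shows "card (winning \<tau> N k j q) = card (winning \<tau> N k (Suc j) (append_value j q (Suc j))) +
    (\<Sum>t = 1..num_vs_lr_max j q. card (winning \<tau> N k (Suc j) (append_value j q (Suc j - t))))"
proof -
  let ?r = "num_vs_lr_max j q"
  let ?f = "\<lambda>t. append_value j q (Suc j - t)"
  have r: "?r \<le> j"
    using num_vs_lr_max_le assms(1) Av321_permutes by blast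
  \<comment> \<open>The last entry determines \<open>t\<close>, as \<open>t \<le> j\<close> prevents
    truncation in \<open>Suc j - t\<close>.\<close>
  have inj: "inj_on ?f {0..?r}"
  proof (rule inj_onI)
    fix s t assume st: "s \<in> {0..?r}" "t \<in> {0..?r}" "?f s = ?f t"
    then have "Suc j - s = Suc j - t"
      by (metis append_value_Suc_self)
    then show "s = t"
      using st r by auto
  qed
  have children: "winning \<tau> N k j q = (\<Union>t\<in>{0..?r}. winning \<tau> N k (Suc j) (?f t))"
  proof -
    have "p \<in> winning \<tau> N k j q \<longleftrightarrow>
        (\<exists>q' \<in> {q' \<in> Av321 (Suc j). prefix_pattern q' j = q}. p \<in> winning \<tau> N k (Suc j) q')" for p
      using Av321_prefix_pattern[of p N "Suc j"] assms(2) prefix_pattern_prefix_pattern[of j "Suc j" p]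
      unfolding winning_def by auto
    then show ?thesis
      unfolding Av321_children[OF assms(1)] by blast
  qed
  have "card (winning \<tau> N k j q) = (\<Sum>t = 0..?r. card (winning \<tau> N k (Suc j) (?f t)))"
    unfolding children
  proof (rule card_UN_disjoint)
    show "\<forall>t\<in>{0..?r}. finite (winning \<tau> N k (Suc j) (?f t))"
      using finite_Av321 by (simp add: winning_def)
    show "\<forall>s\<in>{0..?r}. \<forall>t\<in>{0..?r}. s \<noteq> t \<longrightarrow>
        winning \<tau> N k (Suc j) (?f s) \<inter> winning \<tau> N k (Suc j) (?f t) = {}"
    proof (intro ballI impI)
      fix s t assume st: "s \<in> {0..?r}" "t \<in> {0..?r}" "s \<noteq> t"
      show "winning \<tau> N k (Suc j) (?f s) \<inter> winning \<tau> N k (Suc j) (?f t) = {}"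
        using winning_disjoint inj_on_eq_iff[OF inj st(1,2)] st(3) by blast
    qed
  qed simp
  also have "\<dots> = card (winning \<tau> N k (Suc j) (?f 0)) +
      (\<Sum>t = 1..?r. card (winning \<tau> N k (Suc j) (?f t)))"
    by (subst sum.atLeast_Suc_atMost) simp_all
  finally show ?thesis
    by simp
qed

text \<open>
  Both count winning leaves \<open>i\<close> levels below a node with parameter \<open>r\<close>: \<open>held_count\<close> when the accepted
  entry is the current maximum, so that no new maximum may follow; \<open>open_count\<close> when nothing has been
  accepted yet.
\<close>

primrec held_count :: "nat \<Rightarrow> nat \<Rightarrow> nat" where
  "held_count 0 r = 1"
| "held_count (Suc i) r = (\<Sum>t = 1..r. held_count i t)"

primrec open_count :: "(nat \<Rightarrow> enat) \<Rightarrow> nat \<Rightarrow> nat \<Rightarrow> nat" where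
  "open_count \<tau> 0 r = 0"
| "open_count \<tau> (Suc i) r =
     (if \<tau> i \<le> enat (Suc r) then held_count i (Suc r) else open_count \<tau> i (Suc r)) +
     (\<Sum>t = 1..r. open_count \<tau> i t)"

lemma child_Av321:
  assumes "q \<in> Av321 j" "t \<le> num_vs_lr_max j q"
  shows "append_value j q (Suc j - t) \<in> Av321 (Suc j)"
proof -
  have "append_value j q (Suc j - t) \<in> {q' \<in> Av321 (Suc j). prefix_pattern q' j = q}"
    unfolding Av321_children[OF assms(1)] using assms(2) by simp
  then show ?thesis
    by simp
qed

lemma acceptable_append_value:
  assumes "q permutes {1..j}" "i \<le> j"
  shows "acceptable \<tau> N k (append_value j q v) i \<longleftrightarrow> acceptable \<tau> N k q i"
  using acceptable_prefix_pattern[OF assms(2), of \<tau> N k "append_value j q v"]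
    prefix_pattern_append_value[OF assms(1), of v] by simp

definition first_acceptable :: "(nat \<Rightarrow> enat) \<Rightarrow> nat \<Rightarrow> nat \<Rightarrow> (nat \<Rightarrow> nat) \<Rightarrow> nat \<Rightarrow> bool" where
  "first_acceptable \<tau> N k q i \<longleftrightarrow>
     acceptable \<tau> N k q i \<and> (\<forall>l<i. \<not> acceptable \<tau> N k q l)"

lemma first_acceptable_unique:
  "first_acceptable \<tau> N k q i \<Longrightarrow> first_acceptable \<tau> N k q l \<Longrightarrow> i = l"
  unfolding first_acceptable_def by (metis linorder_neqE_nat)

lemma first_acceptable_append_value:
  assumes "q permutes {1..j}" "i \<le> j"
  shows "first_acceptable \<tau> N k (append_value j q v) i \<longleftrightarrow> first_acceptable \<tau> N k q i"
  using assms acceptable_append_value[OF assms(1)] unfolding first_acceptable_def by auto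

section \<open>Counting winning leaves after and before acceptance\<close>

lemma card_winning_final:
  assumes "q \<in> Av321 N"
  shows "card (winning \<tau> N k N q) = of_bool (wins \<tau> N k q)"
proof -
  have "winning \<tau> N k N q = (if wins \<tau> N k q then {q} else {})"
    using assms prefix_pattern_self[OF Av321_permutes] unfolding winning_def by auto
  then show ?thesis
    by simp
qed

text \<open>After acceptance at \<open>i\<close>, winning means that its entry stays the largest up
  to level \<open>N\<close>. A new maximum loses for good; any other child lifts a largest entry
  \<open>j\<close> to \<open>Suc j\<close> and makes no other entry of \<open>q\<close> the
  largest.\<close>

lemma card_winning_held:
  assumes "j \<le> N" "q \<in> Av321 j" "i \<le> j" "first_acceptable \<tau> N k q i"
  shows "card (winning \<tau> N k j q) =
    (if q i = j then held_count (N - j) (num_vs_lr_max j q) else 0)"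
  using assms
proof (induction j arbitrary: q rule: inc_induct)
  case base
  have "wins \<tau> N k q \<longleftrightarrow> q i = N"
    using base(3) first_acceptable_unique[OF base(3)]
    unfolding wins_def first_acceptable_def[symmetric] conj_assoc[symmetric] by blast
  then show ?case
    using card_winning_final[OF base(1)] by simp
next
  case (step j)
  have q: "q permutes {1..j}"
    using step.prems Av321_permutes by blast
  have i: "i \<in> {1..j}"
    using step.prems by (auto simp: first_acceptable_def acceptable_def)
  then have qi: "q i \<in> {1..j}"
    using permutes_in_image[OF q] by blast
  let ?r = "num_vs_lr_max j q"
  have r: "?r \<le> j"
    using num_vs_lr_max_le[OF q] .
  have IH: "card (winning \<tau> N k (Suc j) (append_value j q (Suc j - t))) =
      (if append_value j q (Suc j - t) i = Suc j
       then held_count (N - Suc j) (num_vs_lr_max (Suc j) (append_value j q (Suc j - t))) else 0)"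
    if "t \<le> ?r" for t
    using step.IH[OF child_Av321[OF step.prems(1) that]] step.prems
      first_acceptable_append_value[OF q step.prems(2)] by simp
  have "card (winning \<tau> N k (Suc j) (append_value j q (Suc j))) = 0"
    using IH[of 0] qi i by (simp add: append_value_def)
  moreover have "card (winning \<tau> N k (Suc j) (append_value j q (Suc j - t))) =
      (if q i = j then held_count (N - Suc j) t else 0)" if "t \<in> {1..?r}" for t
  proof -
    have "append_value j q (Suc j - t) i = Suc j \<longleftrightarrow> q i = j"
      using i qi that r by (auto simp: append_value_def)
    then show ?thesis
      using IH[of t] num_vs_append_nonmax[OF q that] that by simp
  qed
  ultimately have "card (winning \<tau> N k j q) =
      (\<Sum>t = 1..?r. if q i = j then held_count (N - Suc j) t else 0)"
    using card_winning_step[OF step.prems(1) step.hyps(2)] by simp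
  also have "\<dots> = (if q i = j then held_count (N - j) ?r else 0)"
    by (simp add: Suc_diff_Suc[OF step.hyps(2), symmetric])
  finally show ?case .
qed

lemma acceptable_append_value_Suc:
  assumes "q permutes {1..j}" "k \<le> j" "j < N" "v \<in> {1..Suc j}"
  shows "acceptable \<tau> N k (append_value j q v) (Suc j) \<longleftrightarrow>
    v = Suc j \<and> \<tau> (N - Suc j) \<le> enat (Suc (num_vs_lr_max j q))"
  using assms lr_max_append_value_Suc[OF assms(1,4)] num_vs_append_max[OF assms(1)]
    prefix_pattern_self[OF append_value_permutes[OF assms(1,4)]]
  unfolding acceptable_def by auto

text \<open>Only the child with a new maximum can trigger acceptance, with \<open>N - Suc j\<close>
  entries to follow; the threshold decides whether its count is \<open>held_count\<close> or
  \<open>open_count\<close>. All other children stay open.\<close>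

lemma card_winning_open:
  assumes "j \<le> N" "k \<le> j" "q \<in> Av321 j" "\<And>i. i \<le> j \<Longrightarrow> \<not> acceptable \<tau> N k q i"
  shows "card (winning \<tau> N k j q) = open_count \<tau> (N - j) (num_vs_lr_max j q)"
  using assms
proof (induction j arbitrary: q rule: inc_induct)
  case base
  \<comment> \<open>Acceptable positions are at most \<open>N\<close>, so none remains at this
    level.\<close>
  have "\<not> wins \<tau> N k q"
    using base(3) unfolding wins_def acceptable_def by auto
  then show ?case
    using card_winning_final[OF base(2)] by simp
next
  case (step j)
  have q: "q permutes {1..j}"
    using step.prems Av321_permutes by blast
  let ?r = "num_vs_lr_max j q"
  have r: "?r \<le> j"
    using num_vs_lr_max_le[OF q] .
  have early: "\<not> acceptable \<tau> N k (append_value j q v) i" if "i \<le> j" for v i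
    using acceptable_append_value[OF q that] step.prems(3)[OF that] by simp
  have IH: "card (winning \<tau> N k (Suc j) (append_value j q (Suc j - t))) =
      open_count \<tau> (N - Suc j) (num_vs_lr_max (Suc j) (append_value j q (Suc j - t)))"
    if "t \<le> ?r" "\<not> acceptable \<tau> N k (append_value j q (Suc j - t)) (Suc j)" for t
  proof (rule step.IH)
    show "k \<le> Suc j"
      using step.prems(1) by simp
    show "append_value j q (Suc j - t) \<in> Av321 (Suc j)"
      using child_Av321[OF step.prems(2) that(1)] .
    show "\<not> acceptable \<tau> N k (append_value j q (Suc j - t)) i" if "i \<le> Suc j" for i
      using early[of i] \<open>\<not> acceptable \<tau> N k (append_value j q (Suc j - t)) (Suc j)\<close> that
      by (cases "i = Suc j") auto
  qed
  have nonmax: "card (winning \<tau> N k (Suc j) (append_value j q (Suc j - t))) =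
      open_count \<tau> (N - Suc j) t" if "t \<in> {1..?r}" for t
  proof -
    have "Suc j - t \<in> {1..Suc j}" "Suc j - t \<noteq> Suc j"
      using that r by auto
    then have "\<not> acceptable \<tau> N k (append_value j q (Suc j - t)) (Suc j)"
      using acceptable_append_value_Suc[OF q step.prems(1) step.hyps(2)] by blast
    then show ?thesis
      using IH[of t] num_vs_append_nonmax[OF q that] that by simp
  qed
  have "card (winning \<tau> N k (Suc j) (append_value j q (Suc j))) =
    (if \<tau> (N - Suc j) \<le> enat (Suc ?r) then held_count (N - Suc j) (Suc ?r)
     else open_count \<tau> (N - Suc j) (Suc ?r))"
  proof (cases "\<tau> (N - Suc j) \<le> enat (Suc ?r)")
    case True
    then have "first_acceptable \<tau> N k (append_value j q (Suc j)) (Suc j)"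
      using acceptable_append_value_Suc[OF q step.prems(1) step.hyps(2), of "Suc j"] early
      by (auto simp: first_acceptable_def)
    then show ?thesis
      using card_winning_held[of "Suc j" N "append_value j q (Suc j)" "Suc j" \<tau> k] step.hyps
        child_Av321[OF step.prems(2), of 0] num_vs_append_max[OF q] True
      by (simp add: append_value_Suc_self)
  next
    case False
    then show ?thesis
      using IH[of 0] acceptable_append_value_Suc[OF q step.prems(1) step.hyps(2), of "Suc j"]
        num_vs_append_max[OF q] by simp
  qed
  then have "card (winning \<tau> N k j q) = open_count \<tau> (Suc (N - Suc j)) ?r"
    using card_winning_step[OF step.prems(2) step.hyps(2)] nonmax by simp
  then show ?case
    using step.hyps by (simp add: Suc_diff_Suc)
qed

text \<open>The root is the identity of length \<open>k\<close>: all its entries are saturated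
  maxima, and acceptance requires a position beyond \<open>k\<close>.\<close>

lemma B_c_eq_open_count:
  assumes "k \<le> N"
  shows "B_c \<tau> N k = open_count \<tau> (N - k) k"
proof -
  have id: "id permutes {1..k}" "(id :: nat \<Rightarrow> nat) \<in> Av321 k"
    by (auto simp: Av321_def permutes_id)
  have "num_vs_lr_max k id = k"
    by (rule num_vs_lr_max_eqI[OF id(1)]) (auto simp: lr_max_def)
  moreover have "B_c \<tau> N k = card (winning \<tau> N k k id)"
    by (simp add: B_c_def winning_def)
  ultimately show ?thesis
    using card_winning_open[OF assms order.refl id(2), of \<tau>] by (simp add: acceptable_def)
qed

section \<open>Ballot numbers and the transfer operator\<close>

text \<open>The operator T: it sums \<open>f\<close> over the parameters of the children of a node
  with parameter \<open>r\<close>.\<close>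

definition transfer :: "(nat \<Rightarrow> real) \<Rightarrow> nat \<Rightarrow> real" where
  "transfer f r = f (Suc r) + (\<Sum>t = 1..r. f t)"

text \<open>The ballot number of shift \<open>i\<close> at \<open>N\<close> and \<open>k\<close>,
  with \<open>r = k\<close> and \<open>s = N - k - i\<close>, so that \<open>transfer\<close> raises
  only \<open>s\<close>.\<close>

definition ballot :: "nat \<Rightarrow> nat \<Rightarrow> real" where
  "ballot s r = (real r + 1) / (real s + real r + 1) * real ((2 * s + r) choose (s + r))"

lemma choose_pred_mult:
  assumes "0 < s" "s \<le> n"
  shows "(real n - real s + 1) * real (n choose (s - 1)) = real s * real (n choose s)"
proof -
  obtain t where t: "s = Suc t"
    using assms gr0_implies_Suc by blast
  have "real (n - t) * real (n choose t) = real (Suc t) * real (n choose Suc t)"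
    unfolding of_nat_mult[symmetric] using binomial_absorb_comp[of n t] binomial_absorption[of t n] by simp
  then show ?thesis
    using assms t by (simp add: of_nat_diff)
qed

text \<open>The reflection form, to which Pascal's rule applies termwise. At \<open>s = 0\<close>
  the truncated \<open>s - 1\<close> would contribute a spurious 1, hence the case
  distinction.\<close>

lemma ballot_eq_choose_diff:
  "ballot s r = real ((2 * s + r) choose s) - (if s = 0 then 0 else real ((2 * s + r) choose (s - 1)))"
proof -
  have sym: "(2 * s + r) choose (s + r) = (2 * s + r) choose s"
    using binomial_symmetric[of s "2 * s + r"] by simp
  show ?thesis
  proof (cases "s = 0")
    case True
    then show ?thesis
      by (simp add: ballot_def add.commute[of 1])
  next
    case False
    then have "(real s + real r + 1) * real ((2 * s + r) choose (s - 1)) =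
        real s * real ((2 * s + r) choose s)"
      using choose_pred_mult[of s "2 * s + r"] by (simp add: algebra_simps)
    then show ?thesis
      using False unfolding ballot_def sym by (simp add: field_simps)
  qed
qed

lemma ballot_0: "ballot 0 r = 1"
  by (simp add: ballot_eq_choose_diff)

lemma ballot_Suc_Suc: "ballot (Suc s) (Suc r) = ballot (Suc s) r + ballot s (Suc (Suc r))"
  by (cases s) (simp_all add: ballot_eq_choose_diff)

text \<open>After Pascal's rule only row \<open>2 * s + 1\<close> occurs, whose two middle binomials
  agree by symmetry.\<close>

lemma ballot_Suc_0: "ballot (Suc s) 0 = ballot s 1"
proof -
  have "(2 * s + 1) choose (Suc s) = (2 * s + 1) choose s"
    using binomial_symmetric[of s "2 * s + 1"] by simp
  then show ?thesis
    by (cases s) (simp_all add: ballot_eq_choose_diff)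
qed

lemma transfer_Suc: "transfer f (Suc r) = transfer f r + f (Suc (Suc r))"
  by (simp add: transfer_def)

text \<open>Both sides satisfy the recurrence \<open>ballot_Suc_Suc\<close> in \<open>r\<close> and
  agree at \<open>r = 0\<close> by \<open>ballot_Suc_0\<close>.\<close>

lemma transfer_ballot: "transfer (ballot s) r = ballot (Suc s) r"
  by (induction r) (simp_all add: transfer_Suc ballot_Suc_Suc ballot_Suc_0, simp add: transfer_def)

lemma ballot_1: "ballot 1 r = real r + 1"
  by (induction r) (simp_all add: ballot_Suc_Suc ballot_Suc_0 ballot_0)

lemma ballot_2: "ballot 2 r = (real r + 1) * (real r + 4) / 2"
proof -
  have "ballot (Suc 1) r = (real r + 1) * (real r + 4) / 2"
    by (induction r) (simp_all only: ballot_Suc_Suc ballot_Suc_0 ballot_1, simp_all add: field_simps)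
  then show ?thesis
    by (simp add: numeral_2_eq_2)
qed

lemma ballot_3: "ballot 3 r = (real r + 1) * (real r + 5) * (real r + 6) / 6"
proof -
  have "ballot (Suc 2) r = (real r + 1) * (real r + 5) * (real r + 6) / 6"
    by (induction r) (simp_all only: ballot_Suc_Suc ballot_Suc_0 ballot_2, simp_all add: field_simps)
  then show ?thesis
    by (simp add: numeral_3_eq_3 numeral_2_eq_2)
qed

lemma transfer_add: "transfer (\<lambda>r. f r + g r) r = transfer f r + transfer g r"
  by (simp add: transfer_def sum.distrib)

lemma transfer_diff: "transfer (\<lambda>r. f r - g r) r = transfer f r - transfer g r"
  by (simp add: transfer_def sum_subtractf)

lemma transfer_scale: "transfer (\<lambda>r. c * f r) r = c * transfer f r"
  by (simp add: transfer_def sum_distrib_left distrib_left)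

section \<open>Remainders of finite support\<close>

definition list_fun :: "real list \<Rightarrow> nat \<Rightarrow> real" where
  "list_fun xs r = (if r < length xs then xs ! r else 0)"

lemma sum_list_fun: "(\<Sum>t = 1..r. list_fun (x # xs) t) = sum_list (take r xs)"
  by (induction r) (auto simp: list_fun_def take_Suc_conv_app_nth)

text \<open>\<open>transfer f r\<close> adds \<open>f 1\<close> up to \<open>f (Suc r)\<close>, so
  the value at 0 drops out and partial sums of \<open>xs\<close> remain. Once \<open>xs\<close> is
  exhausted they are constant; for nonempty \<open>xs\<close>, subtracting that constant leaves a
  list two entries shorter than \<open>x # xs\<close>.\<close>

lemma transfer_list_fun: "transfer (list_fun (x # xs)) r = sum_list (take (Suc r) xs)"
proof -
  have "transfer (list_fun (x # xs)) r = (\<Sum>t = 1..Suc r. list_fun (x # xs) t)"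
    by (simp add: transfer_def)
  then show ?thesis
    by (simp only: sum_list_fun)
qed

section \<open>Counts for the thresholds 1, 1, 4, 9\<close>

text \<open>The threshold is infinite from index 4 on, so a new maximum is never accepted
  there.\<close>

lemma open_count_tau149_Suc:
  assumes "4 \<le> i"
  shows "real (open_count tau149 (Suc i) r) = transfer (\<lambda>t. real (open_count tau149 i t)) r"
  using assms by (simp add: tau149_def transfer_def)

lemma open_count_tau149_1: "open_count tau149 1 r = 1"
  by (simp add: tau149_def one_enat_def)

lemma held_count_1: "held_count (Suc 0) r = r"
  by simp

lemma open_count_tau149_2: "open_count tau149 2 r = 2 * r + 1"
proof -
  have "open_count tau149 (Suc 1) r = 2 * r + 1"
    unfolding open_count.simps(2) open_count_tau149_1 by (simp add: tau149_def one_enat_def)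
  then show ?thesis
    by (simp add: numeral_2_eq_2)
qed

lemma held_count_2: "real (held_count 2 r) = real r * (real r + 1) / 2"
proof -
  have "real (held_count (Suc (Suc 0)) r) = real r * (real r + 1) / 2"
    unfolding held_count.simps(2)[of "Suc 0"] held_count_1 by (induction r) (simp_all add: field_simps)
  then show ?thesis
    by (simp add: numeral_2_eq_2)
qed

lemma held_count_3: "real (held_count 3 r) = real r * (real r + 1) * (real r + 2) / 6"
proof -
  have "real (held_count (Suc 2) r) = real r * (real r + 1) * (real r + 2) / 6"
    unfolding held_count.simps(2)[of 2] of_nat_sum held_count_2
    by (induction r) (simp_all add: field_simps)
  then show ?thesis
    by (simp add: numeral_3_eq_3 numeral_2_eq_2)
qed

lemma sum_odd: "(\<Sum>t = 1..r. 2 * t + 1) = r * (r + (2::nat))"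
  by (induction r) simp_all

text \<open>The threshold 4 is met when \<open>Suc r \<ge> 4\<close>, hence the split at 3. Below
  it, the new maximum stays open and contributes the count at distance 2 with parameter
  \<open>Suc r\<close>.\<close>

lemma open_count_tau149_3:
  "real (open_count tau149 3 r) =
     (if r < 3 then 2 * real r + 3 else (real r + 1) * (real r + 2) / 2) + real r * (real r + 2)"
proof -
  have "real (open_count tau149 (Suc 2) r) =
     (if r < 3 then 2 * real r + 3 else (real r + 1) * (real r + 2) / 2) + real r * (real r + 2)"
    unfolding open_count.simps(2) open_count_tau149_2 sum_odd
    by (simp add: tau149_def held_count_2 numeral_eq_enat algebra_simps del: One_nat_def)
  then show ?thesis
    by (simp add: numeral_3_eq_3 numeral_2_eq_2)
qed

text \<open>The threshold 9 is met when \<open>Suc r \<ge> 9\<close>; the cubic is then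
  \<open>held_count 3 (Suc r)\<close>.\<close>

lemma open_count_tau149_4_rec:
  "real (open_count tau149 4 r) =
     (if r < 8 then real (open_count tau149 3 (Suc r)) else (real r + 1) * (real r + 2) * (real r + 3) / 6) +
     (\<Sum>t = 1..r. real (open_count tau149 3 t))"
proof -
  have "open_count tau149 4 r = open_count tau149 (Suc 3) r"
    by simp
  then show ?thesis
    by (simp only: open_count.simps(2))
      (simp add: tau149_def held_count_3 numeral_eq_enat add.commute del: open_count.simps)
qed

text \<open>For \<open>r \<ge> 8\<close> the count is a cubic polynomial. In the basis
  \<open>ballot 0\<close> to \<open>ballot 3\<close>, of degrees 0 to 3, its coefficient at
  \<open>ballot 1\<close> is zero, which is why shift 3 is missing from the final formula. The list
  holds the deviations at \<open>r < 8\<close>.\<close>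

lemma open_count_tau149_4:
  "real (open_count tau149 4 r) = 4 * ballot 3 r - 9 * ballot 2 r + 2 * ballot 0 r +
     list_fun [4, 10, 15, 19, 21, 20, 15, 5] r"
proof (cases "r < 8")
  case True
  then have "r \<in> {0, 1, 2, 3, 4, 5, 6, 7}"
    by auto
  then show ?thesis
    unfolding open_count_tau149_4_rec open_count_tau149_3 ballot_0 ballot_2 ballot_3 list_fun_def
    by (auto simp: sum.atLeast_Suc_atMost numeral_eq_Suc)
next
  case False
  then have "8 \<le> r"
    by simp
  then have "real (open_count tau149 4 r) = 4 * ballot 3 r - 9 * ballot 2 r + 2"
  \<comment> \<open>The value at 8 is computed; beyond it both sides have the same polynomial
    increments.\<close>
  proof (induction r rule: dec_induct)
    case base
    show ?case
      unfolding open_count_tau149_4_rec open_count_tau149_3 ballot_2 ballot_3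
      by (simp add: sum.atLeast_Suc_atMost numeral_eq_Suc)
  next
    case (step r)
    then show ?case
      unfolding open_count_tau149_4_rec ballot_2 ballot_3
      by (simp add: open_count_tau149_3 field_simps)
  qed
  then show ?thesis
    using False by (simp add: ballot_0 list_fun_def)
qed

lemmas transfer_linear = transfer_add transfer_diff transfer_scale transfer_ballot transfer_list_fun

lemma open_count_tau149_5:
  "real (open_count tau149 5 r) = 4 * ballot 4 r - 9 * ballot 3 r + 2 * ballot 1 r + 105 * ballot 0 r +
     list_fun [-95, -80, -61, -40, -20, -5] r"
proof -
  \<comment> \<open>The total of the tail is 105; the new list consists of the proper partial sums
    minus 105. The next levels follow the same pattern.\<close>
  have "sum_list (take (Suc r) [10, 15, 19, 21, 20, 15, 5 :: real]) =
      105 * ballot 0 r + list_fun [-95, -80, -61, -40, -20, -5] r"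
    by (auto simp: ballot_0 list_fun_def take_Cons' nth_Cons')
  then show ?thesis
    using open_count_tau149_Suc[of 4 r]
    by (simp add: open_count_tau149_4 transfer_linear del: open_count.simps)
qed

lemma open_count_tau149_6:
  "real (open_count tau149 6 r) = 4 * ballot 5 r - 9 * ballot 4 r + 2 * ballot 2 r + 105 * ballot 1 r
     - 206 * ballot 0 r + list_fun [126, 65, 25, 5] r"
proof -
  have "sum_list (take (Suc r) [-80, -61, -40, -20, -5 :: real]) =
      list_fun [126, 65, 25, 5] r - 206 * ballot 0 r"
    by (auto simp: ballot_0 list_fun_def take_Cons' nth_Cons')
  then show ?thesis
    using open_count_tau149_Suc[of 5 r]
    by (simp add: open_count_tau149_5 transfer_linear del: open_count.simps flip: One_nat_def)
qed

lemma open_count_tau149_7: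
  "real (open_count tau149 7 r) = 4 * ballot 6 r - 9 * ballot 5 r + 2 * ballot 3 r + 105 * ballot 2 r
     - 206 * ballot 1 r + 95 * ballot 0 r + list_fun [-30, -5] r"
proof -
  have "sum_list (take (Suc r) [65, 25, 5 :: real]) = 95 * ballot 0 r + list_fun [-30, -5] r"
    by (auto simp: ballot_0 list_fun_def take_Cons' nth_Cons')
  then show ?thesis
    using open_count_tau149_Suc[of 6 r]
    by (simp add: open_count_tau149_6 transfer_linear del: open_count.simps flip: One_nat_def)
qed

lemma open_count_tau149_ge_8:
  "real (open_count tau149 (n + 8) r) = 4 * ballot (n + 7) r - 9 * ballot (n + 6) r
     + 2 * ballot (n + 4) r + 105 * ballot (n + 3) r - 206 * ballot (n + 2) r
     + 95 * ballot (n + 1) r - 5 * ballot n r"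
proof (induction n arbitrary: r)
  case 0
  \<comment> \<open>The tail of \<open>[-30, -5]\<close> is a single entry, so its partial sums are
    constant and no remainder survives.\<close>
  have "sum_list (take (Suc r) [-5 :: real]) = - 5 * ballot 0 r"
    by (simp add: ballot_0)
  then show ?case
    using open_count_tau149_Suc[of 7 r]
    by (simp add: open_count_tau149_7 transfer_linear del: open_count.simps flip: One_nat_def)
next
  case (Suc n)
  then show ?case
    using open_count_tau149_Suc[of "n + 8" r] by (simp add: transfer_linear del: open_count.simps)
qed

section \<open>Shifted ballot numbers and the final formula\<close>

text \<open>If \<open>i + k > N\<close>, then \<open>2 * (N - i) - k\<close> is below
  \<open>N - i\<close> as an integer, and the binomial is 0 by convention.\<close>

lemma shifted_ballot_eq:
  "i \<le> N \<Longrightarrow> shifted_ballot i N k = (if i + k \<le> N then ballot (N - k - i) k else 0)"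
proof (cases "i + k \<le> N")
  case True
  then obtain s where s: "N = i + k + s"
    using le_Suc_ex by blast
  have "2 * (int N - int i) - int k = int (2 * s + k)" "int N - int i = int (s + k)"
    using s by simp_all
  then show ?thesis
    using s by (simp only: shifted_ballot_def binom0_def nat_int) (simp add: ballot_def)
qed (simp add: shifted_ballot_def binom0_def)

theorem theorem4p11:
  fixes N k :: nat
  assumes "N \<ge> 11" and "1 \<le> k" and "k \<le> N - 5"
  shows "real (B_c tau149 N k) =
           4 * shifted_ballot 1 N k - 9 * shifted_ballot 2 N k + 2 * shifted_ballot 4 N k
           + 105 * shifted_ballot 5 N k - 206 * shifted_ballot 6 N k
           + 95 * shifted_ballot 7 N k - 5 * shifted_ballot 8 N k"
proof -
  have B: "real (B_c tau149 N k) = real (open_count tau149 (N - k) k)"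
    using assms by (simp add: B_c_eq_open_count)
  \<comment> \<open>At distances 5, 6, 7 a remainder is left, supported on \<open>r < 6\<close>,
    \<open>r < 4\<close>, \<open>r < 2\<close>. There \<open>N \<ge> 11\<close> forces
    \<open>k\<close> to be at least 6, 5, 4, so it vanishes at \<open>k\<close>, and so do the
    shifted ballot numbers with \<open>i + k > N\<close>.\<close>
  consider "N = k + 5" | "N = k + 6" | "N = k + 7" | "k + 8 \<le> N"
    using assms by linarith
  then show ?thesis
  proof cases
    case 1
    with assms B show ?thesis
      by (simp add: shifted_ballot_eq open_count_tau149_5 list_fun_def del: open_count.simps)
  next
    case 2
    with assms B show ?thesis
      by (simp add: shifted_ballot_eq open_count_tau149_6 list_fun_def del: open_count.simps)
  next
    case 3
    with assms B show ?thesis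
      by (simp add: shifted_ballot_eq open_count_tau149_7 list_fun_def del: open_count.simps)
  next
    case 4
    define n where "n = N - k - 8"
    with 4 have N: "N = k + (n + 8)"
      by simp
    then have "i \<le> 8 \<Longrightarrow> shifted_ballot i N k = ballot (n + (8 - i)) k" for i
      by (simp add: shifted_ballot_eq)
    with N B show ?thesis
      by (simp add: open_count_tau149_ge_8 add.commute del: open_count.simps)
  qed
qed

end
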